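(* Let $X_1,X_2$ be two zero-dimensional Hausdorff spaces and $f:X_1\to X_2$ a continuous function. Let $\beta_0f:\beta_0X_1\to\beta_0X_2$ be the continuous extension of $f$ over the Banaschewski compactifications. Then: (a) $\beta_0f$ is quasi-open iff $f$ is skeletal; (b) $\beta_0f$ is an open map iff $f$ satisfies (ZOB): for every $F\in CO(X_1)$, $\mathrm{cl}_{X_2}(f(F))\in CO(X_2)$; (c) $\beta_0f$ is a surjection iff $\mathrm{cl}_{X_2}(f(X_1))=X_2$; (d) $\beta_0f$ is an injection iff $f^{-1}(CO(X_2))=CO(X_1)$, where $f^{-1}(CO(X_2))=\{f^{-1}(G) : G\in CO(X_2)\}$.
   Context: A space is zero-dimensional if it has a base of clopen sets. $CO(X)$ is the Boolean algebra of clopen subsets of $X$. The Banaschewski compactification $(\beta_0X,\beta_0)$ of a zero-dimensional Hausdorff space $X$ is its greatest zero-dimensional Hausdorff compactification; up to equivalence, $\beta_0X$ is the set of all ultrafilters in $CO(X)$ with open base $\{\{u : a\in u\} : a\in CO(X)\}$, and $\beta_0:X\to\beta_0X$ is the dense embedding $x\mapsto\{F\in CO(X) : x\in F\}$. For continuous $f:X_1\to X_2$, $\beta_0f:\beta_0X_1\to\beta_0X_2$ is the (unique) continuous map such that $\beta_0f$ composed with the embedding $X_1\to\beta_0X_1$ equals $f$ followed by the embedding $X_2\to\beta_0X_2$. A function $h:X\to Y$ is skeletal if $\mathrm{int}(h^{-1}(\mathrm{cl}(V)))\subseteq\mathrm{cl}(h^{-1}(V))$ for every open $V\subseteq Y$.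 A continuous map $h:X\to Y$ is quasi-open if $\mathrm{int}(h(U))\ne\emptyset$ for every non-empty open $U\subseteq X$. Open maps are continuous and not necessarily onto. *)

theory Defs
  imports "HOL-Analysis.Analysis"
begin

definition CO :: "'a topology \<Rightarrow> 'a set set" where
  "CO X = {A. openin X A \<and> closedin X A}"

definition zero_dimensional_space :: "'a topology \<Rightarrow> bool" where
  "zero_dimensional_space X \<longleftrightarrow>
     (\<exists>\<B>. \<B> \<subseteq> CO X \<and> openin X = arbitrary union_of (\<lambda>U. U \<in> \<B>))"

text \<open>Filters in the Boolean algebra \<open>CO X\<close> (order: inclusion, top: \<open>topspace X\<close>,
  bottom: \<open>{}\<close>); ultrafilters are the maximal proper filters.  If \<open>X\<close> is empty the algebra is
  degenerate and has no ultrafilters.\<close>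

definition CO_filter :: "'a topology \<Rightarrow> 'a set set \<Rightarrow> bool" where
  "CO_filter X u \<longleftrightarrow> u \<subseteq> CO X \<and> topspace X \<in> u \<and>
     (\<forall>A\<in>u. \<forall>B\<in>u. A \<inter> B \<in> u) \<and>
     (\<forall>A\<in>u. \<forall>B\<in>CO X. A \<subseteq> B \<longrightarrow> B \<in> u)"

definition CO_ultrafilter :: "'a topology \<Rightarrow> 'a set set \<Rightarrow> bool" where
  "CO_ultrafilter X u \<longleftrightarrow> CO_filter X u \<and> {} \<notin> u \<and>
     (\<forall>v. CO_filter X v \<and> {} \<notin> v \<and> u \<subseteq> v \<longrightarrow> v = u)"

text \<open>The Banaschewski compactification, as the space of ultrafilters of clopen sets.\<close>

definition beta0 :: "'a topology \<Rightarrow> 'a set set topology" where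
  "beta0 X = topology (arbitrary union_of
     (\<lambda>W. W \<in> {{u. CO_ultrafilter X u \<and> A \<in> u} |A. A \<in> CO X}))"

definition beta0_embed :: "'a topology \<Rightarrow> 'a \<Rightarrow> 'a set set" where
  "beta0_embed X x = {F \<in> CO X. x \<in> F}"

text \<open>The extension is determined only on the carrier of \<open>beta0 X\<close>, whence the extensionality
  requirement; existence and uniqueness are shown in \<open>beta0_map_ex1\<close> below.\<close>

definition beta0_map :: "'a topology \<Rightarrow> 'b topology \<Rightarrow> ('a \<Rightarrow> 'b) \<Rightarrow> 'a set set \<Rightarrow> 'b set set" where
  "beta0_map X Y f = (THE g. g \<in> extensional (topspace (beta0 X)) \<and>
     continuous_map (beta0 X) (beta0 Y) g \<and>
     (\<forall>x\<in>topspace X. g (beta0_embed X x) = beta0_embed Y (f x)))"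

definition skeletal_map :: "'a topology \<Rightarrow> 'b topology \<Rightarrow> ('a \<Rightarrow> 'b) \<Rightarrow> bool" where
  "skeletal_map X Y h \<longleftrightarrow> h \<in> topspace X \<rightarrow> topspace Y \<and>
     (\<forall>V. openin Y V \<longrightarrow>
        X interior_of {x \<in> topspace X. h x \<in> Y closure_of V}
          \<subseteq> X closure_of {x \<in> topspace X. h x \<in> V})"

definition quasi_open_map :: "'a topology \<Rightarrow> 'b topology \<Rightarrow> ('a \<Rightarrow> 'b) \<Rightarrow> bool" where
  "quasi_open_map X Y h \<longleftrightarrow> continuous_map X Y h \<and>
     (\<forall>U. openin X U \<and> U \<noteq> {} \<longrightarrow> Y interior_of (h ` U) \<noteq> {})"

definition ZOB :: "'a topology \<Rightarrow> 'b topology \<Rightarrow> ('a \<Rightarrow> 'b) \<Rightarrow> bool" where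
  "ZOB X Y f \<longleftrightarrow> (\<forall>F\<in>CO X. Y closure_of (f ` F) \<in> CO Y)"


lemma CO_closed:
  assumes "A \<in> CO X" "B \<in> CO X"
  shows "A \<inter> B \<in> CO X" "A \<union> B \<in> CO X" "topspace X - A \<in> CO X"
  using assms unfolding CO_def by (auto simp: openin_diff closedin_diff)

lemma CO_trivial: "{} \<in> CO X" "topspace X \<in> CO X"
  by (auto simp: CO_def)

lemma CO_vimage:
  assumes "continuous_map X Y f" "G \<in> CO Y"
  shows "{x \<in> topspace X. f x \<in> G} \<in> CO X"
  using assms openin_continuous_map_preimage[OF assms(1)] closedin_continuous_map_preimage[OF assms(1)]
  by (simp add: CO_def)

lemma CO_filterD:
  assumes "CO_filter X u"
  shows "A \<in> u \<Longrightarrow> A \<in> CO X"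
    and "topspace X \<in> u"
    and "A \<in> u \<Longrightarrow> B \<in> u \<Longrightarrow> A \<inter> B \<in> u"
    and "A \<in> u \<Longrightarrow> B \<in> CO X \<Longrightarrow> A \<subseteq> B \<Longrightarrow> B \<in> u"
  using assms by (auto simp: CO_filter_def)

lemma CO_ultrafilterD:
  assumes "CO_ultrafilter X u"
  shows "CO_filter X u" and "{} \<notin> u"
    and "CO_filter X v \<Longrightarrow> {} \<notin> v \<Longrightarrow> u \<subseteq> v \<Longrightarrow> v = u"
  using assms by (simp_all add: CO_ultrafilter_def)

lemma CO_ultrafilter_compl:
  assumes u: "CO_ultrafilter X u" and A: "A \<in> CO X"
  shows "A \<in> u \<longleftrightarrow> topspace X - A \<notin> u"
proof
  show "topspace X - A \<notin> u" if "A \<in> u"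
  proof
    assume "topspace X - A \<in> u"
    with that have "A \<inter> (topspace X - A) \<in> u"
      by (rule CO_filterD(3)[OF CO_ultrafilterD(1)[OF u]])
    then show False
      using CO_ultrafilterD(2)[OF u] by simp
  qed
next
  assume n: "topspace X - A \<notin> u"
  define v where "v = {B \<in> CO X. \<exists>C\<in>u. C \<inter> A \<subseteq> B}"
  note f = CO_ultrafilterD(1)[OF u]
  note sub = CO_filterD(1)[OF f] and top = CO_filterD(2)[OF f] and int = CO_filterD(3)[OF f]
  have "CO_filter X v"
    unfolding CO_filter_def
  proof (intro conjI ballI impI)
    show "v \<subseteq> CO X" by (auto simp: v_def)
    have "A \<subseteq> topspace X" using A by (simp add: CO_def openin_subset)
    then show "topspace X \<in> v" using top by (auto simp: v_def CO_trivial)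
  next
    fix B D assume "B \<in> v" "D \<in> v"
    then obtain C E where "C \<in> u" "E \<in> u" "C \<inter> A \<subseteq> B" "E \<inter> A \<subseteq> D" "B \<in> CO X" "D \<in> CO X"
      unfolding v_def by auto
    then show "B \<inter> D \<in> v"
      unfolding v_def using int[of C E] CO_closed(1)[of B X D] by blast
  next
    fix B D assume "B \<in> v" "D \<in> CO X" "B \<subseteq> D"
    then show "D \<in> v" unfolding v_def by blast
  qed
  moreover have "{} \<notin> v"
  proof
    assume "{} \<in> v"
    then obtain C where C: "C \<in> u" "C \<inter> A = {}" unfolding v_def by auto
    have "C \<subseteq> topspace X - A"
      using C sub[OF C(1)] by (auto simp: CO_def dest: openin_subset)
    then show False
      using n CO_filterD(4)[OF f C(1) CO_closed(3)[OF A A]] by simp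
  qed
  moreover have "u \<subseteq> v"
    using sub by (auto simp: v_def)
  ultimately have "v = u" by (rule CO_ultrafilterD(3)[OF u])
  moreover have "A \<in> v"
    using A top by (auto simp: v_def)
  ultimately show "A \<in> u" by simp
qed

lemma CO_ultrafilterI:
  assumes f: "CO_filter X u" and e: "{} \<notin> u"
    and c: "\<And>A. A \<in> CO X \<Longrightarrow> A \<in> u \<or> topspace X - A \<in> u"
  shows "CO_ultrafilter X u"
  unfolding CO_ultrafilter_def
proof (intro conjI allI impI f e)
  fix v assume "CO_filter X v \<and> {} \<notin> v \<and> u \<subseteq> v"
  then have v: "CO_filter X v" "{} \<notin> v" "u \<subseteq> v" by simp_all
  have "A \<in> u" if "A \<in> v" for A
  proof (rule ccontr)
    assume "A \<notin> u"
    moreover have "A \<in> CO X" using CO_filterD(1)[OF v(1) that] .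
    ultimately have "topspace X - A \<in> v" using c v(3) by blast
    then have "A \<inter> (topspace X - A) \<in> v" by (rule CO_filterD(3)[OF v(1) that])
    then show False using v(2) by simp
  qed
  then show "v = u" using v(3) by (intro equalityI subsetI) auto
qed

lemma beta0_base_Int:
  assumes "A \<in> CO X" "B \<in> CO X"
  shows "{u. CO_ultrafilter X u \<and> A \<in> u} \<inter> {u. CO_ultrafilter X u \<and> B \<in> u}
    = {u. CO_ultrafilter X u \<and> A \<inter> B \<in> u}"
proof -
  have "A \<inter> B \<in> u \<longleftrightarrow> A \<in> u \<and> B \<in> u" if "CO_ultrafilter X u" for u
    using CO_filterD(3,4)[OF CO_ultrafilterD(1)[OF that]] assms
    by (meson inf_le1 inf_le2)
  then show ?thesis by blast
qed

lemma openin_beta0: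
  "openin (beta0 X) =
     arbitrary union_of (\<lambda>W. W \<in> {{u. CO_ultrafilter X u \<and> A \<in> u} |A. A \<in> CO X})"
  unfolding beta0_def
proof (rule topology_inverse', rule istopology_base)
  fix S T assume "S \<in> {{u. CO_ultrafilter X u \<and> A \<in> u} |A. A \<in> CO X}"
    "T \<in> {{u. CO_ultrafilter X u \<and> A \<in> u} |A. A \<in> CO X}"
  then obtain A B where "A \<in> CO X" "B \<in> CO X"
    "S = {u. CO_ultrafilter X u \<and> A \<in> u}" "T = {u. CO_ultrafilter X u \<and> B \<in> u}" by blast
  then show "S \<inter> T \<in> {{u. CO_ultrafilter X u \<and> A \<in> u} |A. A \<in> CO X}"
    using beta0_base_Int[of A X B] CO_closed(1)[of A X B] by blast
qed

lemma openin_beta0_basic: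
  "A \<in> CO X \<Longrightarrow> openin (beta0 X) {u. CO_ultrafilter X u \<and> A \<in> u}"
  unfolding openin_beta0 by (rule arbitrary_union_of_inc) blast

lemma openin_beta0_iff:
  "openin (beta0 X) W \<longleftrightarrow> (\<forall>u\<in>W. \<exists>A\<in>CO X. u \<in> {u. CO_ultrafilter X u \<and> A \<in> u} \<and>
     {u. CO_ultrafilter X u \<and> A \<in> u} \<subseteq> W)"
proof -
  have "(\<exists>U. U \<in> {F A |A. A \<in> C} \<and> x \<in> U \<and> U \<subseteq> W) \<longleftrightarrow> (\<exists>A\<in>C. x \<in> F A \<and> F A \<subseteq> W)"
    for x :: 'c and C :: "'d set" and F W by blast
  then show ?thesis
    unfolding openin_beta0 arbitrary_union_of_alt by (intro ball_cong refl)
qed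

lemma topspace_beta0: "topspace (beta0 X) = {u. CO_ultrafilter X u}"
proof
  show "topspace (beta0 X) \<subseteq> {u. CO_ultrafilter X u}"
    using openin_topspace[of "beta0 X"] unfolding openin_beta0_iff by blast
  have "{u. CO_ultrafilter X u} = {u. CO_ultrafilter X u \<and> topspace X \<in> u}"
    by (auto simp: CO_ultrafilter_def CO_filter_def)
  then show "{u. CO_ultrafilter X u} \<subseteq> topspace (beta0 X)"
    using openin_subset[OF openin_beta0_basic[OF CO_trivial(2)[of X]]] by simp
qed

lemma CO_ultrafilter_embed: "x \<in> topspace X \<Longrightarrow> CO_ultrafilter X (beta0_embed X x)"
  by (rule CO_ultrafilterI; simp add: CO_filter_def beta0_embed_def CO_trivial CO_closed)
     auto

lemma beta0_embed_dense: "beta0 X closure_of (beta0_embed X ` topspace X) = topspace (beta0 X)"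
proof -
  have "\<exists>x\<in>topspace X. beta0_embed X x \<in> T" if "u \<in> T" and T: "openin (beta0 X) T" for u T
  proof -
    have "\<exists>A\<in>CO X. u \<in> {u. CO_ultrafilter X u \<and> A \<in> u} \<and> {u. CO_ultrafilter X u \<and> A \<in> u} \<subseteq> T"
      using T[unfolded openin_beta0_iff] that(1) by (rule bspec)
    then obtain A where A: "A \<in> CO X" "CO_ultrafilter X u" "A \<in> u"
      "{u. CO_ultrafilter X u \<and> A \<in> u} \<subseteq> T" by auto
    then have "A \<noteq> {}" using CO_ultrafilterD(2)[OF A(2)] by auto
    then obtain x where x: "x \<in> A" by blast
    have xX: "x \<in> topspace X" using A(1) x by (auto simp: CO_def dest: openin_subset)
    have "A \<in> beta0_embed X x" using A(1) x by (simp add: beta0_embed_def)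
    then have "beta0_embed X x \<in> T"
      using CO_ultrafilter_embed[OF xX] by (intro subsetD[OF A(4)]) simp
    then show ?thesis using xX by (rule bexI)
  qed
  note * = this
  show ?thesis
    unfolding dense_intersects_open
  proof (intro allI impI)
    fix T assume T: "openin (beta0 X) T \<and> T \<noteq> {}"
    then obtain u where "u \<in> T" by blast
    then obtain x where "x \<in> topspace X" "beta0_embed X x \<in> T" using * T by blast
    then show "beta0_embed X ` topspace X \<inter> T \<noteq> {}" by blast
  qed
qed

lemma Hausdorff_beta0: "Hausdorff_space (beta0 X)"
  unfolding Hausdorff_space_def
proof (intro allI impI)
  fix u v assume a: "u \<in> topspace (beta0 X) \<and> v \<in> topspace (beta0 X) \<and> u \<noteq> v"
  then have uv: "CO_ultrafilter X u" "CO_ultrafilter X v" by (auto simp: topspace_beta0)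
  have "\<not> u \<subseteq> v"
    using CO_ultrafilterD(3)[OF uv(1) CO_ultrafilterD(1,2)[OF uv(2)]] a by auto
  then obtain A where A: "A \<in> u" "A \<notin> v" by blast
  have AC: "A \<in> CO X" using CO_filterD(1)[OF CO_ultrafilterD(1)[OF uv(1)] A(1)] .
  have "topspace X - A \<in> v" using CO_ultrafilter_compl[OF uv(2) AC] A by blast
  moreover have "disjnt {u. CO_ultrafilter X u \<and> A \<in> u} {u. CO_ultrafilter X u \<and> topspace X - A \<in> u}"
    using CO_ultrafilter_compl[OF _ AC] unfolding disjnt_def by blast
  ultimately show "\<exists>U V. openin (beta0 X) U \<and> openin (beta0 X) V \<and> u \<in> U \<and> v \<in> V \<and> disjnt U V"
    using openin_beta0_basic[OF AC] openin_beta0_basic[OF CO_closed(3)[OF AC AC]] uv A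
    by blast
qed

lemma beta0_map_ex1:
  assumes f: "continuous_map X Y f"
  shows "\<exists>!g. g \<in> extensional (topspace (beta0 X)) \<and>
     continuous_map (beta0 X) (beta0 Y) g \<and>
     (\<forall>x\<in>topspace X. g (beta0_embed X x) = beta0_embed Y (f x))"
proof (rule ex_ex1I)
  let ?P = "\<lambda>G. {x \<in> topspace X. f x \<in> G}"
  define h where "h = (\<lambda>u. {G \<in> CO Y. ?P G \<in> u})"
  define g where "g = restrict h (topspace (beta0 X))"
  have fX: "f x \<in> topspace Y" if "x \<in> topspace X" for x
    using f that by (auto simp: continuous_map_def)
  have hu: "CO_ultrafilter Y (h u)" if u: "CO_ultrafilter X u" for u
  proof (rule CO_ultrafilterI)
    have F: "CO_filter X u" using u by (rule CO_ultrafilterD)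
    show "CO_filter Y (h u)"
      unfolding CO_filter_def
    proof (intro conjI ballI impI)
      show "h u \<subseteq> CO Y" by (auto simp: h_def)
      have "?P (topspace Y) = topspace X" using fX by blast
      then show "topspace Y \<in> h u" using CO_filterD(2)[OF F] by (simp add: h_def CO_trivial)
    next
      fix A B assume "A \<in> h u" "B \<in> h u"
      moreover have "?P (A \<inter> B) = ?P A \<inter> ?P B" by blast
      ultimately show "A \<inter> B \<in> h u"
        using CO_filterD(3)[OF F, of "?P A" "?P B"] by (simp add: h_def CO_closed)
    next
      fix A B assume "A \<in> h u" "B \<in> CO Y" "A \<subseteq> B"
      moreover then have "?P A \<subseteq> ?P B" by blast
      ultimately show "B \<in> h u"
        using CO_filterD(4)[OF F _ CO_vimage[OF f], of "?P A" B] by (simp add: h_def)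
    qed
    show "{} \<notin> h u" using CO_ultrafilterD(2)[OF u] by (simp add: h_def)
  next
    fix A assume A: "A \<in> CO Y"
    have "?P (topspace Y - A) = topspace X - ?P A" using fX by blast
    then show "A \<in> h u \<or> topspace Y - A \<in> h u"
      using CO_ultrafilter_compl[OF u CO_vimage[OF f A]] A by (auto simp: h_def CO_closed)
  qed
  have "continuous_map (beta0 X) (beta0 Y) h"
    unfolding continuous_map_def
  proof (intro conjI allI impI)
    show "h \<in> topspace (beta0 X) \<rightarrow> topspace (beta0 Y)"
      using hu by (simp add: topspace_beta0)
  next
    fix W assume W: "openin (beta0 Y) W"
    show "openin (beta0 X) {u \<in> topspace (beta0 X). h u \<in> W}"
      unfolding openin_beta0_iff
    proof
      fix u assume u: "u \<in> {u \<in> topspace (beta0 X). h u \<in> W}"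
      then obtain G where G: "G \<in> CO Y" "G \<in> h u" "{v. CO_ultrafilter Y v \<and> G \<in> v} \<subseteq> W"
        using W unfolding openin_beta0_iff by blast
      then have "{u. CO_ultrafilter X u \<and> ?P G \<in> u} \<subseteq> {u \<in> topspace (beta0 X). h u \<in> W}"
        using hu by (auto simp: topspace_beta0 h_def)
      moreover have "?P G \<in> u" using G by (simp add: h_def)
      ultimately show "\<exists>A\<in>CO X. u \<in> {u. CO_ultrafilter X u \<and> A \<in> u} \<and>
          {u. CO_ultrafilter X u \<and> A \<in> u} \<subseteq> {u \<in> topspace (beta0 X). h u \<in> W}"
        using CO_vimage[OF f G(1)] u by (auto simp: topspace_beta0)
    qed
  qed
  then have "continuous_map (beta0 X) (beta0 Y) g"
    by (rule continuous_map_eq) (simp add: g_def)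
  moreover have "g (beta0_embed X x) = beta0_embed Y (f x)" if "x \<in> topspace X" for x
    using that CO_vimage[OF f] CO_ultrafilter_embed[OF that]
    by (auto simp: g_def h_def topspace_beta0 beta0_embed_def)
  ultimately show "\<exists>g. g \<in> extensional (topspace (beta0 X)) \<and>
     continuous_map (beta0 X) (beta0 Y) g \<and>
     (\<forall>x\<in>topspace X. g (beta0_embed X x) = beta0_embed Y (f x))"
    by (intro exI[of _ g]) (simp add: g_def)
next
  fix g g'
  assume 1: "g \<in> extensional (topspace (beta0 X)) \<and> continuous_map (beta0 X) (beta0 Y) g \<and>
     (\<forall>x\<in>topspace X. g (beta0_embed X x) = beta0_embed Y (f x))"
    and 2: "g' \<in> extensional (topspace (beta0 X)) \<and> continuous_map (beta0 X) (beta0 Y) g' \<and>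
     (\<forall>x\<in>topspace X. g' (beta0_embed X x) = beta0_embed Y (f x))"
  have "g u = g' u" if "u \<in> topspace (beta0 X)" for u
  proof (rule forall_in_closure_of_eq[of u "beta0 X" "beta0_embed X ` topspace X" "beta0 Y" g g'])
    show "u \<in> beta0 X closure_of (beta0_embed X ` topspace X)"
      using that by (simp add: beta0_embed_dense)
  qed (use 1 2 in \<open>auto simp: Hausdorff_beta0\<close>)
  then show "g = g'"
    using 1 2 by (auto intro: extensionalityI)
qed

end

theory Submission
  imports Defs
begin

text \<open>Write \<open>s A\<close> for the basic clopen set of ultrafilters containing \<open>A\<close> and \<open>g\<close> for the extension
  of \<open>f\<close>.  The map \<open>g\<close> sends \<open>u\<close> to the set of those \<open>G\<close> whose preimage belongs to \<open>u\<close>, so an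
  ultrafilter \<open>v\<close> lies in the image of \<open>s A\<close> iff every member of \<open>v\<close> meets \<open>f ` A\<close>.  Hence the trace on
  \<open>Y\<close> of the image of \<open>s A\<close> is the closure of \<open>f ` A\<close>, and all four equivalences are read off from
  this.  For (a), skeletality amounts to the closure of \<open>f ` A\<close> having non-empty interior
  for each non-empty clopen \<open>A\<close>.\<close>

text \<open>These sets, \<open>s A\<close> in the overview, form the base of \<open>beta0 X\<close>.
  An abbreviation keeps them syntactically equal to the comprehensions in
  \<open>openin_beta0_iff\<close>.\<close>

abbreviation beta0_basic :: "'a topology \<Rightarrow> 'a set \<Rightarrow> 'a set set set" where
  "beta0_basic X A \<equiv> {u. CO_ultrafilter X u \<and> A \<in> u}"

lemma CO_subset_topspace: "A \<in> CO X \<Longrightarrow> A \<subseteq> topspace X"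
  by (simp add: CO_def openin_subset)

section \<open>Clopen neighbourhoods in zero-dimensional spaces\<close>

lemma zero_dimensional_space_nbhd:
  assumes "zero_dimensional_space X" "openin X W" "x \<in> W"
  obtains A where "A \<in> CO X" "x \<in> A" "A \<subseteq> W"
proof -
  obtain \<B> where B: "\<B> \<subseteq> CO X" "openin X = arbitrary union_of (\<lambda>U. U \<in> \<B>)"
    using assms(1) unfolding zero_dimensional_space_def by blast
  obtain U where "U \<in> \<B>" "x \<in> U" "U \<subseteq> W"
    using assms(2,3) unfolding B(2) arbitrary_union_of_alt by blast
  then show thesis using that B(1) by blast
qed

text \<open>Testing closure on clopen neighbourhoods only is what links it to ultrafilters: those
  neighbourhoods are exactly the members of \<open>beta0_embed X x\<close>.\<close>

lemma zero_dimensional_space_in_closure_of: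
  assumes "zero_dimensional_space X"
  shows "x \<in> X closure_of S \<longleftrightarrow> x \<in> topspace X \<and> (\<forall>A\<in>CO X. x \<in> A \<longrightarrow> A \<inter> S \<noteq> {})"
proof
  assume "x \<in> X closure_of S"
  then show "x \<in> topspace X \<and> (\<forall>A\<in>CO X. x \<in> A \<longrightarrow> A \<inter> S \<noteq> {})"
    unfolding in_closure_of CO_def by blast
next
  assume *: "x \<in> topspace X \<and> (\<forall>A\<in>CO X. x \<in> A \<longrightarrow> A \<inter> S \<noteq> {})"
  have "\<exists>y. y \<in> S \<and> y \<in> T" if T: "x \<in> T" "openin X T" for T
  proof -
    obtain A where "A \<in> CO X" "x \<in> A" "A \<subseteq> T"
      by (rule zero_dimensional_space_nbhd[OF assms T(2,1)])
    then show ?thesis using * by blast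
  qed
  then show "x \<in> X closure_of S" unfolding in_closure_of using * by blast
qed

section \<open>Existence of ultrafilters of clopen sets\<close>

text \<open>Zorn's lemma: the union of a non-empty chain of proper filters is again a proper
  filter.\<close>

lemma CO_ultrafilter_extends_filter:
  assumes "CO_filter X v" "{} \<notin> v"
  obtains u where "CO_ultrafilter X u" "v \<subseteq> u"
proof -
  let ?\<F> = "{w. CO_filter X w \<and> {} \<notin> w \<and> v \<subseteq> w}"
  have "\<exists>M\<in>?\<F>. \<forall>w\<in>?\<F>. M \<subseteq> w \<longrightarrow> w = M"
  proof (rule subset_Zorn_nonempty)
    show "?\<F> \<noteq> {}" using assms by blast
    fix C assume ne: "C \<noteq> {}" and C: "subset.chain ?\<F> C"
    have CF: "\<And>w. w \<in> C \<Longrightarrow> CO_filter X w \<and> {} \<notin> w \<and> v \<subseteq> w"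
      and ch: "\<And>w w'. w \<in> C \<Longrightarrow> w' \<in> C \<Longrightarrow> w \<subseteq> w' \<or> w' \<subseteq> w"
      using C unfolding subset_chain_def by auto
    have "CO_filter X (\<Union>C)"
      unfolding CO_filter_def
    proof (intro conjI ballI impI)
      show "\<Union>C \<subseteq> CO X" using CF CO_filterD(1) by blast
      show "topspace X \<in> \<Union>C" using ne CF CO_filterD(2) by blast
    next
      fix A B assume "A \<in> \<Union>C" "B \<in> \<Union>C"
      then obtain w where "w \<in> C" "A \<in> w" "B \<in> w" using ch by blast
      then show "A \<inter> B \<in> \<Union>C" using CF CO_filterD(3) by blast
    next
      fix A B assume "A \<in> \<Union>C" "B \<in> CO X" "A \<subseteq> B"
      then show "B \<in> \<Union>C" using CF CO_filterD(4) by blast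
    qed
    then show "\<Union>C \<in> ?\<F>" using CF ne by blast
  qed
  then obtain u where "CO_filter X u" "{} \<notin> u" "v \<subseteq> u" "\<forall>w\<in>?\<F>. u \<subseteq> w \<longrightarrow> w = u"
    by blast
  then show thesis by (intro that[of u]) (auto simp: CO_ultrafilter_def)
qed

text \<open>The upward closure of such a family is a proper filter. This is how ultrafilters with
  prescribed members are built, both for images of basic sets and for injectivity.\<close>

lemma CO_ultrafilter_extends_directed:
  assumes D: "D \<subseteq> CO X" "D \<noteq> {}" "{} \<notin> D"
    and dir: "\<And>A B. A \<in> D \<Longrightarrow> B \<in> D \<Longrightarrow> \<exists>C\<in>D. C \<subseteq> A \<inter> B"
  obtains u where "CO_ultrafilter X u" "D \<subseteq> u"
proof -
  define v where "v = {B \<in> CO X. \<exists>A\<in>D. A \<subseteq> B}"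
  have "CO_filter X v"
    unfolding CO_filter_def
  proof (intro conjI ballI impI)
    show "v \<subseteq> CO X" by (auto simp: v_def)
    obtain A where A: "A \<in> D" using D(2) by blast
    then have "A \<subseteq> topspace X" by (intro CO_subset_topspace subsetD[OF D(1)])
    with A show "topspace X \<in> v" by (auto simp: v_def CO_trivial)
  next
    fix A B assume "A \<in> v" "B \<in> v"
    then obtain A' B' where *: "A' \<in> D" "B' \<in> D" "A' \<subseteq> A" "B' \<subseteq> B" "A \<in> CO X" "B \<in> CO X"
      by (auto simp: v_def)
    then obtain C where C: "C \<in> D" "C \<subseteq> A' \<inter> B'" using dir by blast
    have "C \<subseteq> A \<inter> B" using C(2) *(3,4) by blast
    then show "A \<inter> B \<in> v" using C(1) CO_closed(1)[OF *(5,6)] unfolding v_def by blast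
  next
    fix A B assume "A \<in> v" "B \<in> CO X" "A \<subseteq> B"
    then show "B \<in> v" by (auto simp: v_def)
  qed
  moreover have "{} \<notin> v" using D(3) by (auto simp: v_def)
  ultimately obtain u where "CO_ultrafilter X u" "v \<subseteq> u"
    by (rule CO_ultrafilter_extends_filter)
  moreover have "D \<subseteq> v" using D(1) by (auto simp: v_def)
  ultimately show thesis by (intro that[of u]) auto
qed

section \<open>Basic open sets and the canonical embedding\<close>

lemma beta0_basic_nonempty:
  assumes "A \<in> CO X" "A \<noteq> {}"
  shows "beta0_basic X A \<noteq> {}"
proof -
  obtain x where x: "x \<in> A" using assms(2) by blast
  then have "x \<in> topspace X" using CO_subset_topspace[OF assms(1)] by blast
  then have "beta0_embed X x \<in> beta0_basic X A"
    using assms(1) x by (simp add: CO_ultrafilter_embed) (simp add: beta0_embed_def)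
  then show ?thesis by blast
qed

lemma openin_beta0_basis:
  assumes "openin (beta0 X) W" "u \<in> W"
  shows "\<exists>A\<in>CO X. A \<in> u \<and> A \<noteq> {} \<and> beta0_basic X A \<subseteq> W"
proof -
  obtain A where A: "A \<in> CO X" "CO_ultrafilter X u" "A \<in> u" "beta0_basic X A \<subseteq> W"
    using assms unfolding openin_beta0_iff by blast
  then have "A \<noteq> {}" using CO_ultrafilterD(2)[OF A(2)] by auto
  then show ?thesis using A by blast
qed

text \<open>The preimage of \<open>beta0_basic X A\<close> is \<open>A\<close>. Continuity is used
  for the open-map criterion, to pull an open image back to the codomain of
  \<open>f\<close>.\<close>

lemma continuous_map_beta0_embed: "continuous_map X (beta0 X) (beta0_embed X)"
  unfolding continuous_map_def
proof (intro conjI allI impI)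
  show "beta0_embed X \<in> topspace X \<rightarrow> topspace (beta0 X)"
    by (simp add: topspace_beta0 CO_ultrafilter_embed)
  fix W assume W: "openin (beta0 X) W"
  show "openin X {x \<in> topspace X. beta0_embed X x \<in> W}"
  proof (subst openin_subopen, intro ballI)
    fix x assume "x \<in> {x \<in> topspace X. beta0_embed X x \<in> W}"
    then have "x \<in> topspace X" "beta0_embed X x \<in> W" by auto
    then obtain A where A: "A \<in> CO X" "A \<in> beta0_embed X x" "beta0_basic X A \<subseteq> W"
      using openin_beta0_basis[OF W] by blast
    have "y \<in> topspace X \<and> beta0_embed X y \<in> W" if "y \<in> A" for y
    proof
      show y: "y \<in> topspace X" using CO_subset_topspace[OF A(1)] that by blast
      have "A \<in> beta0_embed X y" using A(1) that by (simp add: beta0_embed_def)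
      then show "beta0_embed X y \<in> W" using A(3) CO_ultrafilter_embed[OF y] by blast
    qed
    then show "\<exists>T. openin X T \<and> x \<in> T \<and> T \<subseteq> {x \<in> topspace X. beta0_embed X x \<in> W}"
      using A(1,2) by (intro exI[of _ A]) (auto simp: CO_def beta0_embed_def)
  qed
qed

section \<open>The extended map on ultrafilters\<close>

lemma beta0_map_props:
  assumes "continuous_map X Y f"
  shows "continuous_map (beta0 X) (beta0 Y) (beta0_map X Y f)"
    and "x \<in> topspace X \<Longrightarrow> beta0_map X Y f (beta0_embed X x) = beta0_embed Y (f x)"
  using theI'[OF beta0_map_ex1[OF assms]] unfolding beta0_map_def by blast+

lemma CO_ultrafilter_beta0_map:
  assumes "continuous_map X Y f" "CO_ultrafilter X u"
  shows "CO_ultrafilter Y (beta0_map X Y f u)"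
  using continuous_map_image_subset_topspace[OF beta0_map_props(1)[OF assms(1)]] assms(2)
  by (auto simp: topspace_beta0)

text \<open>Recovers the concrete formula for the extension from continuity and its values on
  embedded points. Continuity gives \<open>A\<close> in \<open>u\<close> whose basic set is mapped
  into that of \<open>G\<close>; evaluating at the points of \<open>A\<close> places
  \<open>A\<close> inside the preimage of \<open>G\<close>.\<close>

lemma in_beta0_map_iff:
  assumes f: "continuous_map X Y f" and u: "CO_ultrafilter X u" and G: "G \<in> CO Y"
  shows "G \<in> beta0_map X Y f u \<longleftrightarrow> {x \<in> topspace X. f x \<in> G} \<in> u"
proof -
  let ?g = "beta0_map X Y f" and ?P = "\<lambda>G. {x \<in> topspace X. f x \<in> G}"
  note gu = CO_ultrafilter_beta0_map[OF f u]
  have 1: "?P H \<in> u" if H: "H \<in> CO Y" "H \<in> ?g u" for H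
  proof -
    have "openin (beta0 X) {w \<in> topspace (beta0 X). ?g w \<in> beta0_basic Y H}"
      by (rule openin_continuous_map_preimage[OF beta0_map_props(1)[OF f] openin_beta0_basic[OF H(1)]])
    moreover have "u \<in> {w \<in> topspace (beta0 X). ?g w \<in> beta0_basic Y H}"
      using u gu H by (simp add: topspace_beta0)
    ultimately obtain A where A: "A \<in> CO X" "A \<in> u"
      "beta0_basic X A \<subseteq> {w \<in> topspace (beta0 X). ?g w \<in> beta0_basic Y H}"
      using openin_beta0_basis by blast
    have "x \<in> ?P H" if "x \<in> A" for x
    proof -
      have x: "x \<in> topspace X" using CO_subset_topspace[OF A(1)] that by blast
      have "beta0_embed X x \<in> beta0_basic X A"
        using CO_ultrafilter_embed[OF x] A(1) that by (simp add: beta0_embed_def)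
      then have "H \<in> ?g (beta0_embed X x)" using A(3) by blast
      then have "H \<in> beta0_embed Y (f x)" by (simp only: beta0_map_props(2)[OF f x])
      then show ?thesis using x by (simp add: beta0_embed_def)
    qed
    then show ?thesis
      using CO_filterD(4)[OF CO_ultrafilterD(1)[OF u] A(2) CO_vimage[OF f H(1)]] by blast
  qed
  \<comment> \<open>The converse follows by applying \<open>1\<close> to the complement of
    \<open>G\<close>, as an ultrafilter contains exactly one of a clopen set and its
    complement.\<close>
  have "?P (topspace Y - G) = topspace X - ?P G"
    using f by (auto simp: continuous_map_def)
  then have "?P G \<notin> u" if "G \<notin> ?g u"
    using that 1[OF CO_closed(3)[OF G G]] CO_ultrafilter_compl[OF gu G]
      CO_ultrafilter_compl[OF u CO_vimage[OF f G]] by simp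
  then show ?thesis using 1[OF G] by blast
qed

section \<open>Images of basic open sets\<close>

lemma beta0_map_image_basic:
  assumes f: "continuous_map X Y f" and A: "A \<in> CO X"
  shows "beta0_map X Y f ` beta0_basic X A = {v. CO_ultrafilter Y v \<and> (\<forall>G\<in>v. G \<inter> f ` A \<noteq> {})}"
proof (intro equalityI subsetI)
  let ?P = "\<lambda>G. {x \<in> topspace X. f x \<in> G}"
  fix v assume "v \<in> beta0_map X Y f ` beta0_basic X A"
  then obtain u where u: "CO_ultrafilter X u" "A \<in> u" and v: "v = beta0_map X Y f u" by blast
  have uv: "CO_ultrafilter Y v" using CO_ultrafilter_beta0_map[OF f u(1)] v by simp
  have "G \<inter> f ` A \<noteq> {}" if "G \<in> v" for G
  proof -
    have "G \<in> CO Y" using CO_filterD(1)[OF CO_ultrafilterD(1)[OF uv] that] .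
    then have "?P G \<in> u" using in_beta0_map_iff[OF f u(1)] v that by blast
    then have "?P G \<inter> A \<in> u" using CO_filterD(3)[OF CO_ultrafilterD(1)[OF u(1)]] u(2) by blast
    then have "?P G \<inter> A \<noteq> {}" using CO_ultrafilterD(2)[OF u(1)] by metis
    then show ?thesis by blast
  qed
  then show "v \<in> {v. CO_ultrafilter Y v \<and> (\<forall>G\<in>v. G \<inter> f ` A \<noteq> {})}" using uv by blast
next
  let ?P = "\<lambda>G. {x \<in> topspace X. f x \<in> G}"
  fix v assume "v \<in> {v. CO_ultrafilter Y v \<and> (\<forall>G\<in>v. G \<inter> f ` A \<noteq> {})}"
  then have v: "CO_ultrafilter Y v" and m: "\<And>G. G \<in> v \<Longrightarrow> G \<inter> f ` A \<noteq> {}" by auto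
  note F = CO_ultrafilterD(1)[OF v]
  have AX: "A \<subseteq> topspace X" using A by (rule CO_subset_topspace)
  \<comment> \<open>An ultrafilter mapped to \<open>v\<close> must contain the preimage of each
    member of \<open>v\<close>. Cutting these with \<open>A\<close> also forces \<open>A\<close>
    into it, and \<open>m\<close> keeps the traces non-empty.\<close>
  define D where "D = (\<lambda>G. ?P G \<inter> A) ` v"
  obtain u where u: "CO_ultrafilter X u" "D \<subseteq> u"
  proof (rule CO_ultrafilter_extends_directed)
    show "D \<subseteq> CO X"
      using CO_filterD(1)[OF F] CO_vimage[OF f] A by (auto simp: D_def intro!: CO_closed)
    show "D \<noteq> {}" using CO_filterD(2)[OF F] by (auto simp: D_def)
    show "{} \<notin> D"
    proof
      assume "{} \<in> D"
      then obtain G where "G \<in> v" "?P G \<inter> A = {}" by (auto simp: D_def)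
      then show False using m[of G] AX by blast
    qed
    fix B C assume "B \<in> D" "C \<in> D"
    then obtain G H where GH: "G \<in> v" "H \<in> v" "B = ?P G \<inter> A" "C = ?P H \<inter> A"
      by (auto simp: D_def)
    then have "?P (G \<inter> H) \<inter> A \<in> D" using CO_filterD(3)[OF F] unfolding D_def by blast
    then show "\<exists>E\<in>D. E \<subseteq> B \<inter> C" by (rule bexI[rotated]) (auto simp: GH)
  qed
  note U = CO_ultrafilterD(1)[OF u(1)]
  have D: "?P G \<inter> A \<in> u" if "G \<in> v" for G using u(2) that unfolding D_def by blast
  have "A \<in> u" using CO_filterD(4)[OF U D[OF CO_filterD(2)[OF F]] A] by blast
  moreover have "v \<subseteq> beta0_map X Y f u"
  proof
    fix G assume G: "G \<in> v"
    then have GC: "G \<in> CO Y" by (rule CO_filterD(1)[OF F])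
    have "?P G \<in> u" using CO_filterD(4)[OF U D[OF G] CO_vimage[OF f GC]] by blast
    then show "G \<in> beta0_map X Y f u" using in_beta0_map_iff[OF f u(1) GC] by simp
  qed
  \<comment> \<open>The inclusion suffices, since \<open>v\<close> is maximal among proper
    filters.\<close>
  then have "beta0_map X Y f u = v"
    using CO_ultrafilterD(3)[OF v] CO_ultrafilterD(1,2)[OF CO_ultrafilter_beta0_map[OF f u(1)]]
    by blast
  ultimately show "v \<in> beta0_map X Y f ` beta0_basic X A" using u(1) by blast
qed

lemma beta0_embed_in_image_iff:
  assumes Y: "zero_dimensional_space Y" and f: "continuous_map X Y f" and A: "A \<in> CO X"
    and y: "y \<in> topspace Y"
  shows "beta0_embed Y y \<in> beta0_map X Y f ` beta0_basic X A \<longleftrightarrow> y \<in> Y closure_of (f ` A)"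
  using y CO_ultrafilter_embed[OF y]
  unfolding beta0_map_image_basic[OF f A] zero_dimensional_space_in_closure_of[OF Y]
  by (auto simp: beta0_embed_def)

lemma beta0_basic_subset_image_iff:
  assumes Y: "zero_dimensional_space Y" and f: "continuous_map X Y f" and A: "A \<in> CO X"
    and G: "G \<in> CO Y"
  shows "beta0_basic Y G \<subseteq> beta0_map X Y f ` beta0_basic X A \<longleftrightarrow> G \<subseteq> Y closure_of (f ` A)"
proof (intro iffI subsetI)
  fix y assume sub: "beta0_basic Y G \<subseteq> beta0_map X Y f ` beta0_basic X A" and y: "y \<in> G"
  have yY: "y \<in> topspace Y" using CO_subset_topspace[OF G] y by blast
  have "beta0_embed Y y \<in> beta0_basic Y G"
    using CO_ultrafilter_embed[OF yY] G y by (simp add: beta0_embed_def)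
  then show "y \<in> Y closure_of (f ` A)" using sub beta0_embed_in_image_iff[OF Y f A yY] by blast
next
  fix v assume sub: "G \<subseteq> Y closure_of (f ` A)" and v: "v \<in> beta0_basic Y G"
  have uf: "CO_ultrafilter Y v" using v by simp
  have "H \<inter> f ` A \<noteq> {}" if H: "H \<in> v" for H
  proof -
    have HG: "H \<inter> G \<in> v" using CO_filterD(3)[OF CO_ultrafilterD(1)[OF uf] H] v by simp
    then obtain y where y: "y \<in> H \<inter> G" using CO_ultrafilterD(2)[OF uf] by (metis ex_in_conv)
    then have "y \<in> Y closure_of (f ` A)" using sub by blast
    then show ?thesis
      using y CO_filterD(1)[OF CO_ultrafilterD(1)[OF uf] H]
      unfolding zero_dimensional_space_in_closure_of[OF Y] by blast
  qed
  then show "v \<in> beta0_map X Y f ` beta0_basic X A"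
    unfolding beta0_map_image_basic[OF f A] using uf by blast
qed

section \<open>Quasi-open extensions and skeletal maps\<close>

lemma quasi_open_beta0_map_iff:
  assumes X: "zero_dimensional_space X" and Y: "zero_dimensional_space Y"
    and f: "continuous_map X Y f"
  shows "quasi_open_map (beta0 X) (beta0 Y) (beta0_map X Y f) \<longleftrightarrow> skeletal_map X Y f"
proof
  let ?g = "beta0_map X Y f" and ?P = "\<lambda>V. {x \<in> topspace X. f x \<in> V}"
  assume q: "quasi_open_map (beta0 X) (beta0 Y) ?g"
  have "x \<in> X closure_of ?P V"
    if V: "openin Y V" and x: "x \<in> X interior_of ?P (Y closure_of V)" for V x
  proof (rule ccontr)
    assume n: "x \<notin> X closure_of ?P V"
    \<comment> \<open>A violation of skeletality at \<open>x\<close> yields a clopen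
      \<open>A\<close> around \<open>x\<close> whose image lies in the closure of \<open>V\<close>
      but misses \<open>V\<close>.\<close>
    have "openin X (X interior_of ?P (Y closure_of V) - X closure_of ?P V)"
      by (simp add: openin_diff)
    then obtain A where A: "A \<in> CO X" "x \<in> A"
      "A \<subseteq> X interior_of ?P (Y closure_of V) - X closure_of ?P V"
      by (rule zero_dimensional_space_nbhd[OF X]) (use x n in auto)
    have AV: "f ` A \<subseteq> Y closure_of V"
      using A(3) interior_of_subset[of X "?P (Y closure_of V)"] by blast
    have "?P V \<subseteq> X closure_of ?P V" by (intro closure_of_subset) auto
    then have AP: "A \<inter> ?P V = {}" using A(3) by blast
    have "beta0 Y interior_of (?g ` beta0_basic X A) \<noteq> {}"
      using q openin_beta0_basic[OF A(1)] beta0_basic_nonempty[OF A(1)] A(2)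
      unfolding quasi_open_map_def by blast
    then obtain v where "v \<in> beta0 Y interior_of (?g ` beta0_basic X A)" by blast
    then obtain G where G: "G \<in> CO Y" "G \<noteq> {}"
      "beta0_basic Y G \<subseteq> beta0 Y interior_of (?g ` beta0_basic X A)"
      using openin_beta0_basis[OF openin_interior_of] by blast
    have Gcl: "G \<subseteq> Y closure_of (f ` A)"
      using order_trans[OF G(3) interior_of_subset] beta0_basic_subset_image_iff[OF Y f A(1) G(1)]
      by simp
    also have "\<dots> \<subseteq> Y closure_of V" using AV by (rule closure_of_minimal) simp
    finally obtain y where "y \<in> G" "y \<in> Y closure_of V" using G(2) by blast
    then obtain z where z: "z \<in> G" "z \<in> V"
      using G(1) unfolding in_closure_of CO_def by blast
    \<comment> \<open>The open set \<open>G \<inter> V\<close> contains a point of the closure of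
      \<open>f\<close> A\<open>, so\<close>f \<open>A\<close> meets \<open>V\<close> after
      all.\<close>
    then have "z \<in> Y closure_of (f ` A)" "openin Y (G \<inter> V)"
      using Gcl G(1) V by (auto simp: CO_def)
    then obtain a where "a \<in> A" "f a \<in> V" using z unfolding in_closure_of by blast
    then show False using AP CO_subset_topspace[OF A(1)] by blast
  qed
  then show "skeletal_map X Y f"
    using f unfolding skeletal_map_def continuous_map_def by blast
next
  let ?g = "beta0_map X Y f" and ?P = "\<lambda>V. {x \<in> topspace X. f x \<in> V}"
  assume sk: "skeletal_map X Y f"
  have "beta0 Y interior_of (?g ` U) \<noteq> {}" if "openin (beta0 X) U" "U \<noteq> {}" for U
  proof -
    obtain u where "u \<in> U" using \<open>U \<noteq> {}\<close> by blast
    then obtain A where A: "A \<in> CO X" "A \<noteq> {}" "beta0_basic X A \<subseteq> U"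
      using openin_beta0_basis[OF \<open>openin (beta0 X) U\<close>] by blast
    have AX: "A \<subseteq> topspace X" using A(1) by (rule CO_subset_topspace)
    then have fA: "f ` A \<subseteq> topspace Y" using f by (auto simp: continuous_map_def)
    have int: "Y interior_of (Y closure_of (f ` A)) \<noteq> {}"
    proof
      assume e: "Y interior_of (Y closure_of (f ` A)) = {}"
      \<comment> \<open>If the closure had empty interior, its complement \<open>V\<close> would be
        dense. Skeletality would then make the preimage of \<open>V\<close> dense in
        \<open>X\<close>, although \<open>A\<close> is open, non-empty and disjoint from it.\<close>
      define V where "V = topspace Y - Y closure_of (f ` A)"
      have "Y closure_of V = topspace Y"
        using e by (simp add: V_def closure_of_complement)
      then have "?P (Y closure_of V) = topspace X" using f by (auto simp: continuous_map_def)
      moreover have "openin Y V" by (simp add: V_def openin_diff)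
      ultimately have "topspace X \<subseteq> X closure_of ?P V"
        using sk unfolding skeletal_map_def by (metis interior_of_topspace)
      moreover obtain a where a: "a \<in> A" using A(2) by blast
      ultimately have "a \<in> X closure_of ?P V" using AX by blast
      moreover have "openin X A" using A(1) by (simp add: CO_def)
      ultimately obtain b where "b \<in> A" "f b \<in> V" using a by (auto simp: in_closure_of)
      then show False using closure_of_subset[OF fA] by (auto simp: V_def)
    qed
    then obtain y where "y \<in> Y interior_of (Y closure_of (f ` A))" by blast
    then obtain G where G: "G \<in> CO Y" "y \<in> G" "G \<subseteq> Y interior_of (Y closure_of (f ` A))"
      by (rule zero_dimensional_space_nbhd[OF Y openin_interior_of])
    have "G \<subseteq> Y closure_of (f ` A)" using G(3) interior_of_subset by (rule order_trans)
    then have "beta0_basic Y G \<subseteq> ?g ` U"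
      using beta0_basic_subset_image_iff[OF Y f A(1) G(1)] A(3) by blast
    then have "beta0_basic Y G \<subseteq> beta0 Y interior_of (?g ` U)"
      by (rule interior_of_maximal[OF _ openin_beta0_basic[OF G(1)]])
    then show ?thesis using beta0_basic_nonempty[OF G(1)] G(2) by blast
  qed
  then show "quasi_open_map (beta0 X) (beta0 Y) ?g"
    using beta0_map_props(1)[OF f] unfolding quasi_open_map_def by blast
qed

section \<open>Open extensions and clopen closures of images\<close>

lemma open_beta0_map_iff:
  assumes Y: "zero_dimensional_space Y" and f: "continuous_map X Y f"
  shows "open_map (beta0 X) (beta0 Y) (beta0_map X Y f) \<longleftrightarrow> ZOB X Y f"
proof
  let ?g = "beta0_map X Y f"
  assume o: "open_map (beta0 X) (beta0 Y) ?g"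
  show "ZOB X Y f"
    unfolding ZOB_def
  proof
    fix A assume A: "A \<in> CO X"
    \<comment> \<open>The closure is the trace on \<open>Y\<close> of an open set of
      \<open>beta0 Y\<close>, hence open.\<close>
    have "Y closure_of (f ` A) = {y \<in> topspace Y. beta0_embed Y y \<in> ?g ` beta0_basic X A}"
      using beta0_embed_in_image_iff[OF Y f A] closure_of_subset_topspace[of Y "f ` A"]
      by (simp add: set_eq_iff subset_iff) metis
    moreover have "openin Y {y \<in> topspace Y. beta0_embed Y y \<in> ?g ` beta0_basic X A}"
      using o openin_beta0_basic[OF A]
      by (intro openin_continuous_map_preimage[OF continuous_map_beta0_embed])
        (simp add: open_map_def)
    ultimately have "openin Y (Y closure_of (f ` A))" by simp
    then show "Y closure_of (f ` A) \<in> CO Y" by (simp add: CO_def)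
  qed
next
  let ?g = "beta0_map X Y f"
  assume z: "ZOB X Y f"
  show "open_map (beta0 X) (beta0 Y) ?g"
    unfolding open_map_def
  proof (intro allI impI, subst openin_subopen, intro ballI)
    fix U v assume U: "openin (beta0 X) U" and "v \<in> ?g ` U"
    then obtain u where u: "u \<in> U" "v = ?g u" by blast
    then obtain A where A: "A \<in> CO X" "A \<in> u" "beta0_basic X A \<subseteq> U"
      using openin_beta0_basis[OF U] by blast
    have uf: "CO_ultrafilter X u" using openin_subset[OF U] u by (auto simp: topspace_beta0)
    \<comment> \<open>By \<open>ZOB\<close> this closure is clopen, so it yields a basic
      neighbourhood of \<open>v\<close> that lies inside the image of
      \<open>beta0_basic X A\<close>.\<close>
    define K where "K = Y closure_of (f ` A)"
    have K: "K \<in> CO Y" using z A(1) by (simp add: ZOB_def K_def)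
    have "f ` A \<subseteq> K"
      using CO_subset_topspace[OF A(1)] f unfolding K_def
      by (intro closure_of_subset) (auto simp: continuous_map_def)
    then have "A \<subseteq> {x \<in> topspace X. f x \<in> K}" using CO_subset_topspace[OF A(1)] by blast
    then have "K \<in> v"
      using CO_filterD(4)[OF CO_ultrafilterD(1)[OF uf] A(2) CO_vimage[OF f K]]
        in_beta0_map_iff[OF f uf K] u(2) by blast
    then have "v \<in> beta0_basic Y K" using CO_ultrafilter_beta0_map[OF f uf] u(2) by simp
    moreover have "beta0_basic Y K \<subseteq> ?g ` U"
      using beta0_basic_subset_image_iff[OF Y f A(1) K] A(3) unfolding K_def by blast
    ultimately show "\<exists>T. openin (beta0 Y) T \<and> v \<in> T \<and> T \<subseteq> ?g ` U"
      using openin_beta0_basic[OF K] by blast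
  qed
qed

section \<open>Surjectivity and dense image\<close>

lemma beta0_basic_topspace: "beta0_basic X (topspace X) = topspace (beta0 X)"
  by (auto simp: topspace_beta0 intro: CO_filterD(2) CO_ultrafilterD(1))

text \<open>The case of \<open>beta0_basic_subset_image_iff\<close> in which both clopen sets are
  the whole spaces; the reverse inclusions hold for every continuous \<open>f\<close>.\<close>

lemma surj_beta0_map_iff:
  assumes Y: "zero_dimensional_space Y" and f: "continuous_map X Y f"
  shows "beta0_map X Y f ` topspace (beta0 X) = topspace (beta0 Y) \<longleftrightarrow>
    Y closure_of (f ` topspace X) = topspace Y"
proof -
  have "beta0_map X Y f ` topspace (beta0 X) \<subseteq> topspace (beta0 Y)"
    by (rule continuous_map_image_subset_topspace[OF beta0_map_props(1)[OF f]])
  moreover have "Y closure_of (f ` topspace X) \<subseteq> topspace Y"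
    by (rule closure_of_subset_topspace)
  ultimately show ?thesis
    using beta0_basic_subset_image_iff[OF Y f CO_trivial(2) CO_trivial(2)]
    unfolding beta0_basic_topspace by (metis subset_antisym order_refl)
qed

section \<open>Injectivity and clopen preimages\<close>

text \<open>If every clopen set is a preimage, an ultrafilter can be read off from its image.
  Otherwise, for a clopen \<open>A\<close> that is no preimage, some ultrafilter containing
  \<open>A\<close> would share its image with one containing the complement.\<close>

lemma inj_beta0_map_iff:
  assumes f: "continuous_map X Y f"
  shows "inj_on (beta0_map X Y f) (topspace (beta0 X)) \<longleftrightarrow>
    {{x \<in> topspace X. f x \<in> G} |G. G \<in> CO Y} = CO X"
proof
  let ?g = "beta0_map X Y f" and ?P = "\<lambda>G. {x \<in> topspace X. f x \<in> G}"
  assume inj: "inj_on ?g (topspace (beta0 X))"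
  have "\<exists>G\<in>CO Y. ?P G = A" if A: "A \<in> CO X" for A
  proof (rule ccontr)
    assume n: "\<not> (\<exists>G\<in>CO Y. ?P G = A)"
    note cA = CO_closed(3)[OF A A]
    \<comment> \<open>These are the clopen sets whose preimage lies inside \<open>A\<close>. No such
      preimage equals \<open>A\<close>, so the differences in \<open>D\<close> are non-empty;
      closure of \<open>\<G>\<close> under unions makes them directed.\<close>
    define \<G> where "\<G> = {G \<in> CO Y. G \<inter> f ` (topspace X - A) = {}}"
    define D where "D = (\<lambda>G. A \<inter> (topspace X - ?P G)) ` \<G>"
    have \<G>0: "{} \<in> \<G>" by (simp add: \<G>_def CO_trivial)
    obtain u where u: "CO_ultrafilter X u" "D \<subseteq> u"
    proof (rule CO_ultrafilter_extends_directed)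
      show "D \<subseteq> CO X"
        using A CO_vimage[OF f] by (auto simp: D_def \<G>_def intro!: CO_closed)
      show "D \<noteq> {}" using \<G>0 by (auto simp: D_def)
      show "{} \<notin> D"
      proof
        assume "{} \<in> D"
        then obtain G where G: "G \<in> \<G>" "A \<inter> (topspace X - ?P G) = {}" by (auto simp: D_def)
        then have "?P G = A" using CO_subset_topspace[OF A] by (auto simp: \<G>_def)
        then show False using n G(1) by (auto simp: \<G>_def)
      qed
      fix B C assume "B \<in> D" "C \<in> D"
      then obtain G H where GH: "G \<in> \<G>" "H \<in> \<G>"
        "B = A \<inter> (topspace X - ?P G)" "C = A \<inter> (topspace X - ?P H)" by (auto simp: D_def)
      have "G \<union> H \<in> \<G>" using GH(1,2) by (auto simp: \<G>_def CO_closed)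
      then have "A \<inter> (topspace X - ?P (G \<union> H)) \<in> D" unfolding D_def by (rule imageI)
      then show "\<exists>E\<in>D. E \<subseteq> B \<inter> C" by (rule bexI[rotated]) (auto simp: GH)
    qed
    note U = CO_ultrafilterD(1)[OF u(1)]
    have D: "A \<inter> (topspace X - ?P G) \<in> u" if "G \<in> \<G>" for G using u(2) that unfolding D_def by blast
    have Au: "A \<in> u" using CO_filterD(4)[OF U D[OF \<G>0] A] by blast
    \<comment> \<open>Injectivity enters here. By \<open>beta0_map_image_basic\<close>, some
      \<open>G\<close> in \<open>?g u\<close> then misses the image of the complement, so it belongs
      to \<open>\<G>\<close>, while \<open>u\<close> was built to avoid the preimages of all members
      of \<open>\<G>\<close>.\<close>
    have "?g u \<notin> ?g ` beta0_basic X (topspace X - A)"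
    proof
      assume "?g u \<in> ?g ` beta0_basic X (topspace X - A)"
      then obtain w where w: "CO_ultrafilter X w" "topspace X - A \<in> w" "?g u = ?g w" by blast
      then have "u = w" using inj u(1) by (auto simp: topspace_beta0 dest: inj_onD)
      then show False using CO_ultrafilter_compl[OF u(1) A] Au w(2) by blast
    qed
    then obtain G where G: "G \<in> ?g u" "G \<inter> f ` (topspace X - A) = {}"
      unfolding beta0_map_image_basic[OF f cA] using CO_ultrafilter_beta0_map[OF f u(1)] by blast
    have GC: "G \<in> CO Y"
      using CO_filterD(1)[OF CO_ultrafilterD(1)[OF CO_ultrafilter_beta0_map[OF f u(1)]] G(1)] .
    then have "A \<inter> (topspace X - ?P G) \<in> u" using D G(2) by (simp add: \<G>_def)
    then have "topspace X - ?P G \<in> u"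
      using CO_filterD(4)[OF U _ CO_closed(3)] CO_vimage[OF f GC] by blast
    then show False
      using in_beta0_map_iff[OF f u(1) GC] G(1) CO_ultrafilter_compl[OF u(1) CO_vimage[OF f GC]]
      by blast
  qed
  then show "{?P G |G. G \<in> CO Y} = CO X" using CO_vimage[OF f] by blast
next
  let ?g = "beta0_map X Y f" and ?P = "\<lambda>G. {x \<in> topspace X. f x \<in> G}"
  assume e: "{?P G |G. G \<in> CO Y} = CO X"
  \<comment> \<open>One inclusion is enough, since the hypotheses are symmetric in \<open>u\<close>
    and \<open>w\<close>.\<close>
  have sub: "u \<subseteq> w" if "CO_ultrafilter X u" "CO_ultrafilter X w" "?g u = ?g w" for u w
  proof
    fix A assume A: "A \<in> u"
    then have "A \<in> CO X" by (rule CO_filterD(1)[OF CO_ultrafilterD(1)[OF that(1)]])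
    then obtain G where "G \<in> CO Y" "A = ?P G" using e by blast
    then show "A \<in> w" using A that in_beta0_map_iff[OF f] by blast
  qed
  show "inj_on ?g (topspace (beta0 X))"
  proof (rule inj_onI)
    fix u w assume "u \<in> topspace (beta0 X)" "w \<in> topspace (beta0 X)" "?g u = ?g w"
    then show "u = w" using sub[of u w] sub[of w u] by (auto simp: topspace_beta0)
  qed
qed

text \<open>Open maps are continuous by convention, whereas \<open>open_map\<close> does not include
  continuity; hence the conjunction in the second clause.\<close>

theorem corollary4p9:
  fixes X1 :: "'a topology" and X2 :: "'b topology" and f :: "'a \<Rightarrow> 'b"
  assumes "zero_dimensional_space X1" and "Hausdorff_space X1"
    and "zero_dimensional_space X2" and "Hausdorff_space X2"
    and "continuous_map X1 X2 f"
  shows "(quasi_open_map (beta0 X1) (beta0 X2) (beta0_map X1 X2 f) \<longleftrightarrow> skeletal_map X1 X2 f)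
    \<and> ((continuous_map (beta0 X1) (beta0 X2) (beta0_map X1 X2 f) \<and>
           open_map (beta0 X1) (beta0 X2) (beta0_map X1 X2 f)) \<longleftrightarrow> ZOB X1 X2 f)
    \<and> (beta0_map X1 X2 f ` topspace (beta0 X1) = topspace (beta0 X2) \<longleftrightarrow>
           X2 closure_of (f ` topspace X1) = topspace X2)
    \<and> (inj_on (beta0_map X1 X2 f) (topspace (beta0 X1)) \<longleftrightarrow>
           {{x \<in> topspace X1. f x \<in> G} |G. G \<in> CO X2} = CO X1)"
  using assms
  by (simp add: beta0_map_props(1) quasi_open_beta0_map_iff open_beta0_map_iff
      surj_beta0_map_iff inj_beta0_map_iff)

end
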